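(* Let $$\Delta_3=\begin{bmatrix}-2&1&1\\1&-1&0\\1&0&-1\end{bmatrix}$$ and let $L(f)=\|\Delta_3 f\|_\infty$ for $f\in\mathbb{R}^3$. Then $L$ is a Leibniz seminorm on $\mathbb{R}^3$ that is not strongly Leibniz. That is, $L(fg)\le\|f\|_\infty L(g)+\|g\|_\infty L(f)$ for all $f,g\in\mathbb{R}^3$, but it is not the case that $L(1/f)\le\|1/f\|_\infty^2\,L(f)$ for every $f\in\mathbb{R}^3$ with all coordinates nonzero.
   Context: $\mathbb{R}^3$ is regarded as a unital algebra under coordinatewise multiplication (so $fg$ is the coordinatewise product and $1/f$ the coordinatewise inverse, with unit $\mathbf{1}=(1,1,1)$), equipped with the norm $\|f\|_\infty=\max_i|f_i|$. A seminorm $L$ on a unital normed algebra $(\mathcal{A},\|\cdot\|)$ is Leibniz if $L(ab)\le\|a\|L(b)+\|b\|L(a)$ for all $a,b\in\mathcal{A}$. It is strongly Leibniz if it is Leibniz, $L(1_{\mathcal{A}})=0$, and $L(a^{-1})\le\|a^{-1}\|^2L(a)$ for every invertible $a\in\mathcal{A}$. (Here $L(\mathbf{1})=0$ since the rows of $\Delta_3$ sum to zero.) *)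

theory Defs
  imports "HOL-Analysis.Analysis"
begin

definition is_seminorm :: "('a::real_vector \<Rightarrow> real) \<Rightarrow> bool" where
  "is_seminorm L \<longleftrightarrow>
     (\<forall>a. 0 \<le> L a) \<and>
     (\<forall>c a. L (c *\<^sub>R a) = \<bar>c\<bar> * L a) \<and>
     (\<forall>a b. L (a + b) \<le> L a + L b)"

(* N is the norm of the algebra. It is an explicit parameter because the norm used on real ^ 3
   below is infnorm, not the Euclidean norm that the type class provides. *)

definition leibniz :: "('a::real_algebra_1 \<Rightarrow> real) \<Rightarrow> ('a \<Rightarrow> real) \<Rightarrow> bool" where
  "leibniz N L \<longleftrightarrow> (\<forall>a b. L (a * b) \<le> N a * L b + N b * L a)"

(* The algebra carries no inverse operation, so invertibility of a is expressed by a two-sided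
   inverse a', which is unique. *)

definition strongly_leibniz :: "('a::real_algebra_1 \<Rightarrow> real) \<Rightarrow> ('a \<Rightarrow> real) \<Rightarrow> bool" where
  "strongly_leibniz N L \<longleftrightarrow>
     leibniz N L \<and> L 1 = 0 \<and>
     (\<forall>a a'. a * a' = 1 \<and> a' * a = 1 \<longrightarrow> L a' \<le> (N a')\<^sup>2 * L a)"

definition \<Delta>\<^sub>3 :: "real ^ 3 ^ 3" where
  "\<Delta>\<^sub>3 = vector [vector [-2,  1,  1],
               vector [ 1, -1,  0],
               vector [ 1,  0, -1]]"

(* On real ^ 3, infnorm is the maximum of the absolute values of the coordinates, the
   multiplication of the type class is coordinatewise, and 1 is the all-ones vector. *)

definition L\<^sub>3 :: "real ^ 3 \<Rightarrow> real" where
  "L\<^sub>3 f = infnorm (\<Delta>\<^sub>3 *v f)"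

end

theory Submission
  imports Defs
begin

text \<open>Write \<open>f = (x, y, z)\<close> and \<open>g = (u, v, w)\<close>. Then \<open>L\<^sub>3 f\<close> is the maximum of
  \<open>\<bar>y - x\<bar>\<close>, \<open>\<bar>z - x\<bar>\<close> and the second difference \<open>\<bar>y + z - 2 * x\<bar>\<close>. The first two are
  differences of point evaluations, and such differences always satisfy the Leibniz inequality,
  because \<open>y * v - x * u = y * (v - u) + u * (y - x)\<close>. The work is in the second difference
  \<open>E = y * v + z * w - 2 * x * u\<close> of the product. With the increments
  \<open>p = y - x\<close>, \<open>q = z - x\<close>, \<open>r = v - u\<close>, \<open>s = w - u\<close> it has three useful forms:
  \<open>E = y * r + z * s + u * (p + q) = v * p + w * q + x * (r + s)
    = x * (r + s) + u * (p + q) + (p * r + q * s)\<close>.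

  If \<open>r\<close> and \<open>s\<close> have the same sign, then \<open>\<bar>r\<bar> + \<bar>s\<bar> = \<bar>r + s\<bar> \<le> L\<^sub>3 g\<close> and the first form
  suffices; if \<open>p\<close> and \<open>q\<close> have the same sign, the second form does. Otherwise both \<open>f\<close> and \<open>g\<close>
  are monotone along the path from the third point through the first to the second. If they run in opposite directions, the
  correction \<open>p * r + q * s\<close> is nonpositive and cannot hurt an upper bound on \<open>E\<close>. If they run
  in the same direction, it can be large, but then the norm bounds on the end values force
  \<open>x\<close> and \<open>u\<close> away from \<open>\<parallel>f\<parallel>\<close> and \<open>\<parallel>g\<parallel>\<close> by enough to compensate; this is
  \<open>comonotone_upper\<close>. Lower bounds follow by replacing \<open>f\<close> with \<open>- f\<close>.

  Strong Leibniz fails at \<open>f = (1, 2, -1)\<close>, whose inverse is \<open>(1, 1/2, -1)\<close>: here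
  \<open>\<parallel>1/f\<parallel> = 1\<close> and \<open>L\<^sub>3 f = 2\<close>, whereas \<open>L\<^sub>3 (1/f) = 5/2\<close>.\<close>

section \<open>The Leibniz inequality for the second difference\<close>

lemma difference_leibniz:
  fixes x y u v F G A B :: real
  assumes "\<bar>y\<bar> \<le> F" "\<bar>u\<bar> \<le> G" "\<bar>y - x\<bar> \<le> A" "\<bar>v - u\<bar> \<le> B"
  shows "\<bar>y * v - x * u\<bar> \<le> F * B + G * A"
proof -
  have "y * v - x * u = y * (v - u) + u * (y - x)"
    by algebra
  also have "\<bar>\<dots>\<bar> \<le> \<bar>y\<bar> * \<bar>v - u\<bar> + \<bar>u\<bar> * \<bar>y - x\<bar>"
    by (metis abs_mult abs_triangle_ineq)
  also have "\<dots> \<le> F * B + G * A"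
    using assms by (intro add_mono mult_mono) auto
  finally show ?thesis .
qed

text \<open>With increments \<open>p\<close>, \<open>- k\<close> of \<open>f\<close> and \<open>r\<close>, \<open>- s\<close> of \<open>g\<close>, where \<open>p, k, r, s \<ge> 0\<close>,
  the bounds on the values at the end points give \<open>k - F \<le> x \<le> F - p\<close> and
  \<open>s - G \<le> u \<le> G - r\<close>. For fixed increments \<open>E\<close> is linear in \<open>x\<close> and in \<open>u\<close>, so
  inserting the worst admissible values leaves an inequality between the increments alone, which
  follows from \<open>p + k \<le> 2 * F\<close> and \<open>r + s \<le> 2 * G\<close>.\<close>

lemma comonotone_upper_increments:
  fixes x u p k r s F G :: real
  assumes "0 \<le> k" "k \<le> p" "0 \<le> r" "0 \<le> s"
    and x: "k - F \<le> x" "x \<le> F - p" and u: "s - G \<le> u" "u \<le> G - r"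
  shows "x * (r - s) + u * (p - k) + (p * r + k * s) \<le> F * max r s + G * p"
proof -
  have F: "p + k \<le> 2 * F" and G: "r + s \<le> 2 * G"
    using x u by linarith+
  have up: "u * (p - k) \<le> (G - r) * (p - k)"
    using assms by (intro mult_right_mono) auto
  show ?thesis
  proof (cases "s \<le> r")
    case True
    have "x * (r - s) \<le> (F - p) * (r - s)"
      using True x by (intro mult_right_mono) auto
    moreover have "(p + k) * s \<le> 2 * F * s" "(r + s) * k \<le> 2 * G * k"
      using F G assms by (auto intro: mult_right_mono)
    moreover have "p * s \<le> p * r" "r * k \<le> r * p"
      using True assms by (auto intro: mult_left_mono)
    ultimately show ?thesis
      using up True by (simp add: algebra_simps max_def)
  next
    case False
    have "x * (r - s) \<le> (k - F) * (r - s)"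
      using False x by (intro mult_right_mono_neg) auto
    moreover have "k * r \<le> F * r" "r * k \<le> G * k"
      using F G False assms by (auto intro!: mult_right_mono)
    ultimately show ?thesis
      using up False by (simp add: algebra_simps max_def)
  qed
qed

text \<open>Negating both functions and exchanging the two end points preserves \<open>E\<close> and the direction
  of monotonicity but exchanges the two increments, so the larger increment of \<open>f\<close>
  may be taken to come first.\<close>

lemma comonotone_upper:
  fixes x y z u v w F G A B :: real
  assumes f: "z \<le> x" "x \<le> y" and g: "w \<le> u" "u \<le> v"
    and F: "\<bar>y\<bar> \<le> F" "\<bar>z\<bar> \<le> F" and G: "\<bar>v\<bar> \<le> G" "\<bar>w\<bar> \<le> G"
    and A: "y - x \<le> A" "x - z \<le> A" and B: "v - u \<le> B" "u - w \<le> B"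
  shows "y * v + z * w - 2 * x * u \<le> F * B + G * A"
proof -
  have nn: "0 \<le> F" "0 \<le> G"
    using F G by linarith+
  show ?thesis
  proof (cases "x - z \<le> y - x")
    case True
    have "x * ((v - u) - (u - w)) + u * ((y - x) - (x - z))
        + ((y - x) * (v - u) + (x - z) * (u - w)) \<le> F * max (v - u) (u - w) + G * (y - x)"
      using True assms by (intro comonotone_upper_increments) auto
    also have "\<dots> \<le> F * B + G * A"
      using nn A B by (intro add_mono mult_left_mono) auto
    finally show ?thesis
      by (simp add: algebra_simps)
  next
    case False
    have "(- x) * ((u - w) - (v - u)) + (- u) * ((x - z) - (y - x))
        + ((x - z) * (u - w) + (y - x) * (v - u)) \<le> F * max (u - w) (v - u) + G * (x - z)"
      using False assms by (intro comonotone_upper_increments) auto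
    also have "\<dots> \<le> F * B + G * A"
      using nn A B by (intro add_mono mult_left_mono) auto
    finally show ?thesis
      by (simp add: algebra_simps)
  qed
qed

text \<open>Here the correction term \<open>p * r + q * s\<close> has the favourable sign.\<close>

lemma countermonotone_upper:
  fixes x y z u v w F G A B :: real
  assumes f: "z \<le> x" "x \<le> y" and g: "u \<le> w" "v \<le> u"
    and F: "\<bar>x\<bar> \<le> F" and G: "\<bar>u\<bar> \<le> G"
    and A: "\<bar>y + z - 2 * x\<bar> \<le> A" and B: "\<bar>v + w - 2 * u\<bar> \<le> B"
  shows "y * v + z * w - 2 * x * u \<le> F * B + G * A"
proof -
  have "(y - x) * (v - u) \<le> 0" "(z - x) * (w - u) \<le> 0"
    using f g by (auto simp: mult_le_0_iff)
  then have "y * v + z * w - 2 * x * u \<le> x * (v + w - 2 * u) + u * (y + z - 2 * x)"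
    by (simp add: algebra_simps)
  also have "\<dots> \<le> \<bar>x\<bar> * \<bar>v + w - 2 * u\<bar> + \<bar>u\<bar> * \<bar>y + z - 2 * x\<bar>"
    by (metis abs_ge_self abs_mult add_mono)
  also have "\<dots> \<le> F * B + G * A"
    using assms by (intro add_mono mult_mono) auto
  finally show ?thesis .
qed

text \<open>When the increments of \<open>g\<close> have the same sign, nothing cancels in \<open>v + w - 2 * u\<close>, so
  that the second difference of \<open>g\<close> controls the sum of the sizes of its increments.\<close>

lemma same_sign_bound:
  fixes x y z u v w F G A B :: real
  assumes same: "0 \<le> (v - u) * (w - u)"
    and F: "\<bar>y\<bar> \<le> F" "\<bar>z\<bar> \<le> F" and G: "\<bar>u\<bar> \<le> G"
    and A: "\<bar>y + z - 2 * x\<bar> \<le> A" and B: "\<bar>v + w - 2 * u\<bar> \<le> B"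
  shows "\<bar>y * v + z * w - 2 * x * u\<bar> \<le> F * B + G * A"
proof -
  have r: "\<bar>v - u\<bar> + \<bar>w - u\<bar> \<le> B"
    using same B by (auto simp: zero_le_mult_iff)
  have "y * v + z * w - 2 * x * u = y * (v - u) + z * (w - u) + u * (y + z - 2 * x)"
    by algebra
  also have "\<bar>\<dots>\<bar> \<le> \<bar>y\<bar> * \<bar>v - u\<bar> + \<bar>z\<bar> * \<bar>w - u\<bar> + \<bar>u\<bar> * \<bar>y + z - 2 * x\<bar>"
    unfolding abs_mult [symmetric] by linarith
  also have "\<dots> \<le> F * \<bar>v - u\<bar> + F * \<bar>w - u\<bar> + G * A"
    using assms by (intro add_mono mult_mono) auto
  also have "\<dots> \<le> F * B + G * A"
    using mult_left_mono [OF r, of F] F by (simp add: algebra_simps)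
  finally show ?thesis .
qed

text \<open>Exchanging the end points reduces to the case that \<open>f\<close> increases from \<open>z\<close> to \<open>y\<close>.\<close>

lemma opposite_signs_upper:
  fixes x y z u v w F G A B :: real
  assumes "(y - x) * (z - x) < 0" "(v - u) * (w - u) < 0"
    and F: "\<bar>x\<bar> \<le> F" "\<bar>y\<bar> \<le> F" "\<bar>z\<bar> \<le> F" and G: "\<bar>u\<bar> \<le> G" "\<bar>v\<bar> \<le> G" "\<bar>w\<bar> \<le> G"
    and A: "\<bar>y - x\<bar> \<le> A" "\<bar>z - x\<bar> \<le> A" "\<bar>y + z - 2 * x\<bar> \<le> A"
    and B: "\<bar>v - u\<bar> \<le> B" "\<bar>w - u\<bar> \<le> B" "\<bar>v + w - 2 * u\<bar> \<le> B"
  shows "y * v + z * w - 2 * x * u \<le> F * B + G * A"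
proof -
  have A': "y - x \<le> A" "x - y \<le> A" "z - x \<le> A" "x - z \<le> A" "\<bar>z + y - 2 * x\<bar> \<le> A"
    using A by (simp_all only: abs_le_iff add.commute minus_diff_eq)
  have B': "v - u \<le> B" "u - v \<le> B" "w - u \<le> B" "u - w \<le> B" "\<bar>w + v - 2 * u\<bar> \<le> B"
    using B by (simp_all only: abs_le_iff add.commute minus_diff_eq)
  consider "z \<le> x" "x \<le> y" "w \<le> u" "u \<le> v" | "z \<le> x" "x \<le> y" "u \<le> w" "v \<le> u"
    | "y \<le> x" "x \<le> z" "w \<le> u" "u \<le> v" | "y \<le> x" "x \<le> z" "u \<le> w" "v \<le> u"
    using assms(1,2) by (auto simp: mult_less_0_iff)
  then show ?thesis
  proof cases
    case 1
    then show ?thesis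
      using comonotone_upper [OF _ _ _ _ F(2,3) G(2,3) A'(1,4) B'(1,4)] by blast
  next
    case 2
    then show ?thesis
      using countermonotone_upper [OF _ _ _ _ F(1) G(1) A(3) B(3)] by blast
  next
    case 3
    then have "z * w + y * v - 2 * x * u \<le> F * B + G * A"
      using countermonotone_upper [OF _ _ _ _ F(1) G(1) A'(5) B'(5)] by blast
    then show ?thesis by simp
  next
    case 4
    then have "z * w + y * v - 2 * x * u \<le> F * B + G * A"
      using comonotone_upper [OF _ _ _ _ F(3,2) G(3,2) A'(3,2) B'(3,2)] by blast
    then show ?thesis by simp
  qed
qed

lemma second_difference_leibniz:
  fixes x y z u v w F G A B :: real
  assumes F: "\<bar>x\<bar> \<le> F" "\<bar>y\<bar> \<le> F" "\<bar>z\<bar> \<le> F"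
    and G: "\<bar>u\<bar> \<le> G" "\<bar>v\<bar> \<le> G" "\<bar>w\<bar> \<le> G"
    and A: "\<bar>y - x\<bar> \<le> A" "\<bar>z - x\<bar> \<le> A" "\<bar>y + z - 2 * x\<bar> \<le> A"
    and B: "\<bar>v - u\<bar> \<le> B" "\<bar>w - u\<bar> \<le> B" "\<bar>v + w - 2 * u\<bar> \<le> B"
  shows "\<bar>y * v + z * w - 2 * x * u\<bar> \<le> F * B + G * A"
proof -
  consider "0 \<le> (v - u) * (w - u)" | "0 \<le> (y - x) * (z - x)"
    | "(y - x) * (z - x) < 0" "(v - u) * (w - u) < 0"
    using not_le by blast
  then show ?thesis
  proof cases
    case 1
    then show ?thesis
      using F(2,3) G(1) A(3) B(3) by (rule same_sign_bound)
  next
    case 2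
    then have "\<bar>v * y + w * z - 2 * u * x\<bar> \<le> G * A + F * B"
      using G(2,3) F(1) B(3) A(3) by (rule same_sign_bound)
    then show ?thesis by (simp only: ac_simps)
  next
    case 3
    then have upper: "y * v + z * w - 2 * x * u \<le> F * B + G * A"
      using F G A B by (rule opposite_signs_upper)
    have "((- y) - (- x)) * ((- z) - (- x)) < 0"
      using 3(1) by (simp add: algebra_simps)
    moreover have "\<bar>- x\<bar> \<le> F" "\<bar>- y\<bar> \<le> F" "\<bar>- z\<bar> \<le> F"
      using F by simp_all
    moreover have "\<bar>(- y) - (- x)\<bar> \<le> A" "\<bar>(- z) - (- x)\<bar> \<le> A" "\<bar>(- y) + (- z) - 2 * (- x)\<bar> \<le> A"
      using A by linarith+
    ultimately have "(- y) * v + (- z) * w - 2 * (- x) * u \<le> F * B + G * A"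
      using 3(2) G B by (intro opposite_signs_upper)
    with upper show ?thesis by (simp add: abs_le_iff)
  qed
qed

section \<open>The seminorm on three points\<close>

lemma infnorm_3: "infnorm (a :: real ^ 3) = max \<bar>a $ 1\<bar> (max \<bar>a $ 2\<bar> \<bar>a $ 3\<bar>)"
  unfolding infnorm_cart UNIV_3 by (rule cSup_eq) auto

lemma L\<^sub>3_eq:
  "L\<^sub>3 f = max \<bar>f $ 2 + f $ 3 - 2 * f $ 1\<bar> (max \<bar>f $ 2 - f $ 1\<bar> \<bar>f $ 3 - f $ 1\<bar>)"
proof -
  have "(\<Delta>\<^sub>3 *v f) $ 1 = f $ 2 + f $ 3 - 2 * f $ 1"
    "(\<Delta>\<^sub>3 *v f) $ 2 = f $ 1 - f $ 2" "(\<Delta>\<^sub>3 *v f) $ 3 = f $ 1 - f $ 3"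
    by (simp_all add: \<Delta>\<^sub>3_def matrix_vector_mult_def sum_3)
  then show ?thesis
    unfolding L\<^sub>3_def infnorm_3 by (simp only: abs_minus_commute)
qed

lemma is_seminorm_L\<^sub>3: "is_seminorm L\<^sub>3"
  unfolding is_seminorm_def L\<^sub>3_def
  by (auto simp: infnorm_pos_le infnorm_mul infnorm_triangle
      matrix_vector_mult_scaleR matrix_vector_right_distrib)

lemma leibniz_L\<^sub>3: "leibniz infnorm L\<^sub>3"
  unfolding leibniz_def
proof (intro allI)
  fix f g :: "real ^ 3"
  have F: "\<bar>f $ i\<bar> \<le> infnorm f" and G: "\<bar>g $ i\<bar> \<le> infnorm g" for i
    by (simp_all add: component_le_infnorm_cart)
  show "L\<^sub>3 (f * g) \<le> infnorm f * L\<^sub>3 g + infnorm g * L\<^sub>3 f"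
    unfolding L\<^sub>3_eq [of "f * g"] max.bounded_iff vector_mult_component mult.assoc [symmetric]
    by (intro conjI second_difference_leibniz difference_leibniz F G) (auto simp: L\<^sub>3_eq)
qed

lemma inverse_inequality_counterexample:
  defines "f \<equiv> vector [1, 2, - 1] :: real ^ 3"
  defines "h \<equiv> vector [1, 1 / 2, - 1] :: real ^ 3"
  shows "f * h = 1" "h * f = 1" "\<forall>i. f $ i \<noteq> 0" "(\<chi> i. 1 / f $ i) = h"
    "\<not> L\<^sub>3 h \<le> (infnorm h)\<^sup>2 * L\<^sub>3 f"
  by (simp_all add: f_def h_def vec_eq_iff forall_3 L\<^sub>3_eq infnorm_3)

theorem mainTheorem3:
  shows "is_seminorm L\<^sub>3 \<and> leibniz infnorm L\<^sub>3 \<and> \<not> strongly_leibniz infnorm L\<^sub>3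
    \<and> (\<forall>f g :: real ^ 3. L\<^sub>3 (f * g) \<le> infnorm f * L\<^sub>3 g + infnorm g * L\<^sub>3 f)
    \<and> \<not> (\<forall>f :: real ^ 3. (\<forall>i. f $ i \<noteq> 0) \<longrightarrow>
            L\<^sub>3 (\<chi> i. 1 / f $ i) \<le> (infnorm (\<chi> i. 1 / f $ i))\<^sup>2 * L\<^sub>3 f)"
proof (intro conjI)
  show "\<not> strongly_leibniz infnorm L\<^sub>3"
    unfolding strongly_leibniz_def using inverse_inequality_counterexample(1,2,5) by blast
  show "\<forall>f g :: real ^ 3. L\<^sub>3 (f * g) \<le> infnorm f * L\<^sub>3 g + infnorm g * L\<^sub>3 f"
    using leibniz_L\<^sub>3 unfolding leibniz_def .
  show "\<not> (\<forall>f :: real ^ 3. (\<forall>i. f $ i \<noteq> 0) \<longrightarrow>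
            L\<^sub>3 (\<chi> i. 1 / f $ i) \<le> (infnorm (\<chi> i. 1 / f $ i))\<^sup>2 * L\<^sub>3 f)"
    using inverse_inequality_counterexample(3,4,5) by metis
qed (fact is_seminorm_L\<^sub>3 leibniz_L\<^sub>3)+

end
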